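(* Let $\Sigma$ and $\Delta$ be graded posets, $\varphi:\Sigma\to\Delta$ a combinatorial morphism, and $m_\Sigma:\Sigma\to\mathbb Z_{\ge1}$ a balanced map. If $\Delta$ is connected in codimension-$k$, and $\varphi$ has a fibre that is connected in codimension-$k$ in $\Sigma$, then $\Sigma$ is connected in codimension-$k$.
   Context: Posets carry the topology whose open sets are the up-closed sets (up-sets); connectedness refers to this topology. For a subset $S$ of $\Sigma$, $\uparrow_\Sigma S$ is the up-set generated by $S$, and $\downarrow_\Sigma\alpha=\{\gamma:\gamma\le\alpha\}$. $\alpha\lessdot\gamma$ means $\gamma$ covers $\alpha$. A graded poset is a finite poset $\Sigma$ with an order-preserving rank function $\mathrm{rk}:\Sigma\to\mathbb N$ such that, for $\alpha<\gamma$, $\alpha\lessdot\gamma$ iff $\mathrm{rk}\,\gamma=\mathrm{rk}\,\alpha+1$; all minimal elements have rank $0$. $\Sigma(k)$ is the set of rank-$k$ elements and $\dim\Sigma$ the maximal value of $\mathrm{rk}$. A graded poset $\Sigma$ of dimension $d$ is connected in codimension-$k$ (for $k\in\{0,\dots,d\}$) if the up-set $\uparrow_\Sigma\Sigma(d-k)$ is connected. A fibre $\varphi^{-1}(\beta)$ is connected in codimension-$k$ in $\Sigma$ if it is nonempty, contained in $\mathcal V=\uparrow_\Sigma\Sigma(\dim\Sigma-k)$, and any two of its elements can be joined by a finite sequence of elements of $\mathcal V$ in which consecutive elements are comparable. An order-preserving map $\varphi:\Sigma\to\Delta$ of finite posets is combinatorial if for all $\alpha\in\Sigma$ it maps $\downarrow_\Sigma\alpha$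 isomorphically onto $\downarrow_\Delta\varphi(\alpha)$. A map $m_\Sigma:\Sigma\to\mathbb Z_{\ge1}$ is balanced (with respect to $\varphi$) if for every $\alpha\in\Sigma$ and every $\beta\in\Delta$ with $\varphi(\alpha)\lessdot\beta$ one has $m_\Sigma(\alpha)=\sum_{\gamma\in\varphi^{-1}(\beta),\ \alpha\lessdot\gamma}m_\Sigma(\gamma)$ (empty sums are $0$).
   Formalization: The formal theorem adds the hypothesis dim Σ = dim Δ; without it the claim fails, e.g. for Δ = two isolated points a, b plus a chain c < d, Σ = {a, b}, φ the inclusion, m = 1, k = 0. Equality is automatic if Δ is pure or φ is surjective. *)

theory Defs
  imports "HOL-Analysis.Abstract_Topology"
begin

text \<open>Finite posets are types of class \<open>{finite, order}\<close>; the down-set of \<open>\<alpha>\<close> is \<open>{..\<alpha>}\<close>.\<close>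

definition upset_topology :: "'a::order topology" where
  "upset_topology = topology (\<lambda>U. \<forall>x\<in>U. \<forall>y. x \<le> y \<longrightarrow> y \<in> U)"

lemma openin_upset_topology:
  "openin upset_topology U \<longleftrightarrow> (\<forall>x\<in>U. \<forall>y. x \<le> y \<longrightarrow> y \<in> U)"
proof -
  have "istopology (\<lambda>U::'a set. \<forall>x\<in>U. \<forall>y. x \<le> y \<longrightarrow> y \<in> U)"
    unfolding istopology_def by blast
  then show ?thesis
    unfolding upset_topology_def by (simp add: topology_inverse')
qed

definition up_set :: "'a::order set \<Rightarrow> 'a set" where
  "up_set S = (\<Union>\<alpha>\<in>S. {\<alpha>..})"

definition covered_by :: "'a::order \<Rightarrow> 'a \<Rightarrow> bool" where
  "covered_by \<alpha> \<gamma> \<longleftrightarrow> \<alpha> < \<gamma> \<and> \<not> (\<exists>\<delta>. \<alpha> < \<delta> \<and> \<delta> < \<gamma>)"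

definition graded_poset :: "('a::{finite,order} \<Rightarrow> nat) \<Rightarrow> bool" where
  "graded_poset rk \<longleftrightarrow>
     mono rk \<and>
     (\<forall>\<alpha> \<gamma>. \<alpha> < \<gamma> \<longrightarrow> (covered_by \<alpha> \<gamma> \<longleftrightarrow> rk \<gamma> = rk \<alpha> + 1)) \<and>
     (\<forall>\<alpha>. \<not> (\<exists>\<beta>. \<beta> < \<alpha>) \<longrightarrow> rk \<alpha> = 0)"

definition poset_dim :: "('a::{finite,order} \<Rightarrow> nat) \<Rightarrow> nat" where
  "poset_dim rk = Max (range rk)"

definition codim_up_set :: "('a::{finite,order} \<Rightarrow> nat) \<Rightarrow> nat \<Rightarrow> 'a set" where
  "codim_up_set rk k = up_set {\<alpha>. rk \<alpha> = poset_dim rk - k}"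

text \<open>The condition \<open>k \<le> poset_dim rk\<close> below keeps the natural number subtraction in
  \<open>codim_up_set\<close> from truncating.\<close>

definition connected_in_codim :: "('a::{finite,order} \<Rightarrow> nat) \<Rightarrow> nat \<Rightarrow> bool" where
  "connected_in_codim rk k \<longleftrightarrow>
     k \<le> poset_dim rk \<and> connectedin upset_topology (codim_up_set rk k)"

definition fibre_connected_in_codim ::
    "('a::{finite,order} \<Rightarrow> nat) \<Rightarrow> nat \<Rightarrow> ('a \<Rightarrow> 'b) \<Rightarrow> 'b \<Rightarrow> bool" where
  "fibre_connected_in_codim rk k \<phi> \<beta> \<longleftrightarrow>
     k \<le> poset_dim rk \<and>
     \<phi> -` {\<beta>} \<noteq> {} \<and>
     \<phi> -` {\<beta>} \<subseteq> codim_up_set rk k \<and>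
     (\<forall>x \<in> \<phi> -` {\<beta>}. \<forall>y \<in> \<phi> -` {\<beta>}.
        (\<lambda>a b. a \<in> codim_up_set rk k \<and> b \<in> codim_up_set rk k \<and> (a \<le> b \<or> b \<le> a))\<^sup>*\<^sup>* x y)"

definition combinatorial :: "('a::{finite,order} \<Rightarrow> 'b::{finite,order}) \<Rightarrow> bool" where
  "combinatorial \<phi> \<longleftrightarrow>
     mono \<phi> \<and>
     (\<forall>\<alpha>. bij_betw \<phi> {..\<alpha>} {..\<phi> \<alpha>} \<and>
          (\<forall>x \<in> {..\<alpha>}. \<forall>y \<in> {..\<alpha>}. x \<le> y \<longleftrightarrow> \<phi> x \<le> \<phi> y))"

definition balanced ::
    "('a::{finite,order} \<Rightarrow> 'b::{finite,order}) \<Rightarrow> ('a \<Rightarrow> int) \<Rightarrow> bool" where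
  "balanced \<phi> m \<longleftrightarrow>
     (\<forall>\<alpha> \<beta>. covered_by (\<phi> \<alpha>) \<beta> \<longrightarrow> m \<alpha> = (\<Sum>\<gamma> | \<phi> \<gamma> = \<beta> \<and> covered_by \<alpha> \<gamma>. m \<gamma>))"

text \<open>For a balanced combinatorial morphism the dimensions of source and target may differ when
  the target is not pure, and then codimension \<open>k\<close> refers to different ranks on the two
  sides. Connectedness in codimension \<open>k\<close> need not lift in that case: let the target be two
  isolated points \<open>a\<close>, \<open>b\<close> together with a chain \<open>c < d\<close>, let the
  source be \<open>{a, b}\<close>, mapped by inclusion with all weights \<open>1\<close>, and take
  \<open>k = 0\<close>. Hence lifting statements need equality of the two dimensions.\<close>

end

theory Submission
  imports Defs
begin

text \<open>Connectedness of a subset of a poset means that any two of its points are joined by a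
  zigzag of comparable points inside the subset (\<open>connectedin_upset_iff_zigzag\<close>), so the
  theorem is a statement about lifting zigzags. A combinatorial morphism lifts downward steps
  because it is an isomorphism on down-sets. It lifts upward steps thanks to the balancing
  condition: a positive weight cannot be an empty sum, so every cover of \<open>\<phi> \<alpha>\<close> is the image of
  a cover of \<open>\<alpha>\<close> (\<open>balanced_lift_up\<close>). Since combinatorial morphisms preserve the rank
  (\<open>combinatorial_rank\<close>), the lifted points stay in the up-set generated by the same rank
  (\<open>combinatorial_up_set_rank_iff\<close>).

  Hence every point of this up-set in \<open>\<Sigma>\<close> is joined to the distinguished fibre, by lifting a zigzag
  from its image to the base point of the fibre; the points of the fibre
  are joined to each other by hypothesis.\<close>

section \<open>Connectedness in the topology of up-sets\<close>

abbreviation comparable_in :: "'a::order set \<Rightarrow> 'a \<Rightarrow> 'a \<Rightarrow> bool" where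
  "comparable_in S \<equiv> \<lambda>a b. a \<in> S \<and> b \<in> S \<and> (a \<le> b \<or> b \<le> a)"

lemma zigzag_sym: "(comparable_in S)\<^sup>*\<^sup>* x y \<Longrightarrow> (comparable_in S)\<^sup>*\<^sup>* y x"
proof -
  assume "(comparable_in S)\<^sup>*\<^sup>* x y"
  moreover have "symp (comparable_in S)"
    by (rule sympI) blast
  ultimately show ?thesis
    by (rule sympD[OF symp_rtranclp, rotated])
qed

lemma topspace_upset_topology [simp]: "topspace upset_topology = UNIV"
proof -
  have "openin upset_topology (UNIV :: 'a set)"
    by (simp add: openin_upset_topology)
  then show ?thesis
    using openin_subset by blast
qed

lemma openin_up_set: "openin upset_topology (up_set S)"
  unfolding openin_upset_topology up_set_def by (auto intro: order_trans)

text \<open>A zigzag class in \<open>S\<close> and its complement are both relatively open; conversely a step between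
  comparable points cannot leave a relatively open set with relatively open complement.\<close>

lemma connectedin_upset_iff_zigzag:
  "connectedin upset_topology S \<longleftrightarrow> (\<forall>x\<in>S. \<forall>y\<in>S. (comparable_in S)\<^sup>*\<^sup>* x y)"
proof
  assume conn: "connectedin upset_topology S"
  show "\<forall>x\<in>S. \<forall>y\<in>S. (comparable_in S)\<^sup>*\<^sup>* x y"
  proof (intro ballI, rule ccontr)
    fix x y assume x: "x \<in> S" and y: "y \<in> S" and "\<not> (comparable_in S)\<^sup>*\<^sup>* x y"
    define C where "C = {z \<in> S. (comparable_in S)\<^sup>*\<^sup>* x z}"
    have closed: "b \<in> C" if "a \<in> C" "b \<in> S" "a \<le> b \<or> b \<le> a" for a b
    proof -
      have "(comparable_in S)\<^sup>*\<^sup>* x a" "comparable_in S a b"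
        using that by (simp_all add: C_def)
      then have "(comparable_in S)\<^sup>*\<^sup>* x b"
        by (rule rtranclp.rtrancl_into_rtrancl)
      then show ?thesis
        using that by (simp add: C_def)
    qed
    have "C \<subseteq> S" "x \<in> C" "y \<in> S - C"
      using x y \<open>\<not> (comparable_in S)\<^sup>*\<^sup>* x y\<close> by (auto simp: C_def)
    moreover have "up_set C \<inter> S = C" "up_set (S - C) \<inter> S = S - C"
      using closed \<open>C \<subseteq> S\<close> by (auto simp: up_set_def)
    ultimately have "S \<subseteq> up_set C \<union> up_set (S - C)" "up_set C \<inter> up_set (S - C) \<inter> S = {}"
      "up_set C \<inter> S \<noteq> {}" "up_set (S - C) \<inter> S \<noteq> {}"
      by blast+
    then show False
      using conn openin_up_set unfolding connectedin by blast
  qed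
next
  assume zigzag: "\<forall>x\<in>S. \<forall>y\<in>S. (comparable_in S)\<^sup>*\<^sup>* x y"
  have False if U: "openin upset_topology U" and V: "openin upset_topology V"
    and cover: "S \<subseteq> U \<union> V" and disj: "U \<inter> V \<inter> S = {}"
    and ne: "U \<inter> S \<noteq> {}" "V \<inter> S \<noteq> {}" for U V
  proof -
    obtain x y where x: "x \<in> U" "x \<in> S" and y: "y \<in> V" "y \<in> S"
      using ne by blast
    have "(comparable_in S)\<^sup>*\<^sup>* x y"
      using zigzag x y by blast
    then have "y \<in> U"
    proof (induction rule: rtranclp_induct)
      case base
      then show ?case using x by simp
    next
      case (step a b)
      then show ?case
        using U V cover disj unfolding openin_upset_topology by blast
    qed
    then show False
      using y disj by blast
  qed
  then show "connectedin upset_topology S"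
    unfolding connectedin by auto
qed

section \<open>Covers in finite posets\<close>

lemma ex_covered_by_above:
  fixes a b :: "'a::{finite,order}"
  assumes "a < b"
  obtains c where "covered_by a c" "c \<le> b"
proof -
  obtain c where c: "c \<in> {a<..b}" "\<And>d. d \<in> {a<..b} \<Longrightarrow> d \<le> c \<Longrightarrow> c = d"
    using finite_has_minimal[of "{a<..b}"] assms by auto
  have "covered_by a c"
    unfolding covered_by_def
  proof (intro conjI notI)
    assume "\<exists>d. a < d \<and> d < c"
    then obtain d where d: "a < d" "d < c" by blast
    then have "d \<le> b" using c(1) by (simp add: order.trans[of d c b])
    then have "c = d" using d by (intro c(2)) simp_all
    then show False using d by simp
  qed (use c(1) in simp)
  then show thesis using that c by simp
qed

lemma ex_covered_by_below:
  fixes a b :: "'a::{finite,order}"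
  assumes "a < b"
  obtains c where "covered_by c b"
proof -
  obtain c where c: "c \<in> {a..<b}" "\<And>d. d \<in> {a..<b} \<Longrightarrow> c \<le> d \<Longrightarrow> c = d"
    using finite_has_maximal[of "{a..<b}"] assms by auto
  have "covered_by c b"
    unfolding covered_by_def
  proof (intro conjI notI)
    assume "\<exists>d. c < d \<and> d < b"
    then obtain d where d: "c < d" "d < b" by blast
    then have "a \<le> d" using c(1) by (simp add: order.trans[of a c d])
    then have "c = d" using d by (intro c(2)) simp_all
    then show False using d by simp
  qed (use c(1) in simp)
  then show thesis using that by blast
qed

section \<open>Combinatorial morphisms\<close>

lemma combinatorial_lift_down:
  assumes "combinatorial \<phi>" and "b \<le> \<phi> x"
  obtains y where "y \<le> x" "\<phi> y = b"
proof -
  have "\<phi> ` {..x} = {..\<phi> x}"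
    using assms(1) unfolding combinatorial_def bij_betw_def by blast
  then have "b \<in> \<phi> ` {..x}"
    using assms(2) by simp
  then show thesis
    using that by auto
qed

lemma combinatorial_le_iff:
  assumes "combinatorial \<phi>" and "x \<le> z" "y \<le> z"
  shows "\<phi> x \<le> \<phi> y \<longleftrightarrow> x \<le> y"
  using assms unfolding combinatorial_def by (meson atMost_iff)

lemma combinatorial_less_iff:
  assumes "combinatorial \<phi>" and "x \<le> z" "y \<le> z"
  shows "\<phi> x < \<phi> y \<longleftrightarrow> x < y"
  using combinatorial_le_iff[OF assms] combinatorial_le_iff[OF assms(1,3,2)]
  by (simp add: less_le_not_le)

lemma combinatorial_covered_by:
  assumes \<phi>: "combinatorial \<phi>" and cov: "covered_by x y"
  shows "covered_by (\<phi> x) (\<phi> y)"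
  unfolding covered_by_def
proof (intro conjI notI)
  have xy: "x < y"
    using cov by (simp add: covered_by_def)
  then show "\<phi> x < \<phi> y"
    using combinatorial_less_iff[OF \<phi>, of x y y] by simp
  assume "\<exists>d. \<phi> x < d \<and> d < \<phi> y"
  then obtain d where d: "\<phi> x < d" "d < \<phi> y" by blast
  then obtain c where c: "c \<le> y" "\<phi> c = d"
    using combinatorial_lift_down[OF \<phi> less_imp_le] by blast
  have "x < c" "c < y"
    using combinatorial_less_iff[OF \<phi>, of x y c] combinatorial_less_iff[OF \<phi>, of c y y] c d xy
    by auto
  then show False
    using cov by (auto simp: covered_by_def)
qed

text \<open>The rank of \<open>x\<close> is the length of a saturated chain from \<open>x\<close> down to a minimal element, and
  the isomorphism of down-sets matches such chains below \<open>x\<close> with those below \<open>\<phi> x\<close>.\<close>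

lemma combinatorial_rank:
  fixes \<phi> :: "'a::{finite,order} \<Rightarrow> 'b::{finite,order}"
  assumes rk: "graded_poset rk" and rk': "graded_poset rk'" and \<phi>: "combinatorial \<phi>"
  shows "rk' (\<phi> x) = rk x"
proof (induction x rule: measure_induct_rule[of rk])
  case (less x)
  show ?case
  proof (cases "\<exists>a. a < x")
    case True
    then obtain a where a: "covered_by a x"
      using ex_covered_by_below by blast
    have "rk x = rk a + 1"
      using rk a unfolding graded_poset_def covered_by_def by blast
    moreover have "rk' (\<phi> x) = rk' (\<phi> a) + 1"
      using rk' combinatorial_covered_by[OF \<phi> a]
      unfolding graded_poset_def covered_by_def by blast
    ultimately show ?thesis
      using less.IH[of a] by simp
  next
    case False
    have "\<not> (\<exists>b. b < \<phi> x)"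
    proof
      assume "\<exists>b. b < \<phi> x"
      then obtain b where b: "b < \<phi> x" by blast
      then obtain a where "a \<le> x" "\<phi> a = b"
        using combinatorial_lift_down[OF \<phi> less_imp_le] by blast
      then show False
        using False b by (metis order_le_less order_less_irrefl)
    qed
    then show ?thesis
      using False rk rk' unfolding graded_poset_def by simp
  qed
qed

lemma combinatorial_up_set_rank_iff:
  assumes rk: "graded_poset rk" and rk': "graded_poset rk'" and \<phi>: "combinatorial \<phi>"
  shows "\<phi> x \<in> up_set {b. rk' b = r} \<longleftrightarrow> x \<in> up_set {a. rk a = r}"
proof
  assume "\<phi> x \<in> up_set {b. rk' b = r}"
  then obtain b where b: "b \<le> \<phi> x" "rk' b = r"
    by (auto simp: up_set_def)
  then obtain a where "a \<le> x" "\<phi> a = b"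
    using combinatorial_lift_down[OF \<phi>] by metis
  then show "x \<in> up_set {a. rk a = r}"
    using b combinatorial_rank[OF assms, of a] by (auto simp: up_set_def)
next
  assume "x \<in> up_set {a. rk a = r}"
  then obtain a where a: "a \<le> x" "rk a = r"
    by (auto simp: up_set_def)
  then have "\<phi> a \<le> \<phi> x"
    using \<phi> unfolding combinatorial_def by (blast dest: monoD)
  then show "\<phi> x \<in> up_set {b. rk' b = r}"
    using a combinatorial_rank[OF assms, of a] by (auto simp: up_set_def)
qed

section \<open>Lifting along balanced morphisms\<close>

text \<open>A saturated chain from \<open>\<phi> x\<close> to \<open>b\<close> lifts one cover at a time: the weight of \<open>x\<close> is nonzero,
  so the balancing sum over the covers of \<open>x\<close> lying over a given cover of \<open>\<phi> x\<close> has a term.\<close>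

lemma balanced_lift_up:
  fixes \<phi> :: "'a::{finite,order} \<Rightarrow> 'b::{finite,order}"
  assumes bal: "balanced \<phi> m" and pos: "\<And>x. m x \<ge> 1" and le: "\<phi> x \<le> b"
  shows "\<exists>y\<ge>x. \<phi> y = b"
  using le
proof (induction "card {\<phi> x..b}" arbitrary: x rule: less_induct)
  case less
  show ?case
  proof (cases "\<phi> x = b")
    case False
    then obtain c where c: "covered_by (\<phi> x) c" "c \<le> b"
      using ex_covered_by_above less.prems order_le_imp_less_or_eq by metis
    have "m x = (\<Sum>y | \<phi> y = c \<and> covered_by x y. m y)"
      using bal c(1) unfolding balanced_def by blast
    then have "{y. \<phi> y = c \<and> covered_by x y} \<noteq> {}"
      using pos[of x] by (metis not_one_le_zero sum.empty)
    then obtain y where y: "\<phi> y = c" "x < y"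
      by (auto simp: covered_by_def)
    have "\<phi> x < c"
      using c by (simp add: covered_by_def)
    then have "{c..b} \<subset> {\<phi> x..b}"
      using less.prems by auto
    then have "card {\<phi> y..b} < card {\<phi> x..b}"
      using y(1) by (simp add: psubset_card_mono)
    then obtain z where z: "y \<le> z" "\<phi> z = b"
      using less.hyps[of y] c(2) y(1) by auto
    have "x \<le> z"
      using less_imp_le[OF y(2)] z(1) by (rule order_trans)
    then show ?thesis
      using z(2) by blast
  qed auto
qed

lemma lift_zigzag:
  fixes \<phi> :: "'a::{finite,order} \<Rightarrow> 'b::{finite,order}"
  assumes "combinatorial \<phi>" and "balanced \<phi> m" and "\<And>x. m x \<ge> 1"
    and V: "\<And>y. \<phi> y \<in> W \<longleftrightarrow> y \<in> V"
    and "(comparable_in W)\<^sup>*\<^sup>* (\<phi> x) b"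
  shows "\<exists>y. \<phi> y = b \<and> (comparable_in V)\<^sup>*\<^sup>* x y"
  using assms(5)
proof (induction rule: rtranclp_induct)
  case base
  then show ?case by blast
next
  case (step b c)
  then obtain y where y: "\<phi> y = b" "(comparable_in V)\<^sup>*\<^sup>* x y"
    by blast
  have "\<exists>z. \<phi> z = c \<and> (y \<le> z \<or> z \<le> y)"
    using balanced_lift_up[OF assms(2,3), of y c] combinatorial_lift_down[OF assms(1), of c y]
      step.hyps(2) y(1) by metis
  then obtain z where z: "\<phi> z = c" "y \<le> z \<or> z \<le> y"
    by blast
  then have "comparable_in V y z"
    using V[of y] V[of z] y(1) step.hyps(2) by simp
  then show ?case
    using rtranclp.rtrancl_into_rtrancl[OF y(2)] z(1) by blast
qed

section \<open>Connectedness in codimension \<open>k\<close>\<close>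

theorem mainTheorem6:
  fixes rk\<^sub>\<Sigma> :: "'a::{finite,order} \<Rightarrow> nat"
    and rk\<^sub>\<Delta> :: "'b::{finite,order} \<Rightarrow> nat"
    and \<phi> :: "'a \<Rightarrow> 'b"
    and m :: "'a \<Rightarrow> int"
    and k :: nat
  assumes "graded_poset rk\<^sub>\<Sigma>"
    and "graded_poset rk\<^sub>\<Delta>"
    and "poset_dim rk\<^sub>\<Sigma> = poset_dim rk\<^sub>\<Delta>"
    and "combinatorial \<phi>"
    and "\<And>\<alpha>. m \<alpha> \<ge> 1"
    and "balanced \<phi> m"
    and "connected_in_codim rk\<^sub>\<Delta> k"
    and "\<exists>\<beta>. fibre_connected_in_codim rk\<^sub>\<Sigma> k \<phi> \<beta>"
  shows "connected_in_codim rk\<^sub>\<Sigma> k"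
proof -
  define V where "V = codim_up_set rk\<^sub>\<Sigma> k"
  define W where "W = codim_up_set rk\<^sub>\<Delta> k"
  have V: "\<phi> x \<in> W \<longleftrightarrow> x \<in> V" for x
    unfolding V_def W_def codim_up_set_def assms(3)
    by (rule combinatorial_up_set_rank_iff[OF assms(1,2,4)])
  have W: "(comparable_in W)\<^sup>*\<^sup>* b c" if "b \<in> W" "c \<in> W" for b c
    using assms(7) that
    unfolding connected_in_codim_def W_def connectedin_upset_iff_zigzag by blast
  obtain \<beta> where \<beta>: "fibre_connected_in_codim rk\<^sub>\<Sigma> k \<phi> \<beta>"
    using assms(8) by blast
  have k: "k \<le> poset_dim rk\<^sub>\<Sigma>" and ne: "\<phi> -` {\<beta>} \<noteq> {}" and sub: "\<phi> -` {\<beta>} \<subseteq> V"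
    using \<beta> unfolding fibre_connected_in_codim_def V_def by blast+
  have fibre: "(comparable_in V)\<^sup>*\<^sup>* x y" if "\<phi> x = \<beta>" "\<phi> y = \<beta>" for x y
    using \<beta> that unfolding fibre_connected_in_codim_def V_def by blast
  have "\<beta> \<in> W"
    using ne sub V by blast
  have to_fibre: "\<exists>y. \<phi> y = \<beta> \<and> (comparable_in V)\<^sup>*\<^sup>* x y" if "x \<in> V" for x
    using lift_zigzag[OF assms(4,6,5) V] W[OF _ \<open>\<beta> \<in> W\<close>] V that by blast
  have "(comparable_in V)\<^sup>*\<^sup>* x x'" if "x \<in> V" "x' \<in> V" for x x'
  proof -
    obtain y y' where y: "\<phi> y = \<beta>" "(comparable_in V)\<^sup>*\<^sup>* x y"
      and y': "\<phi> y' = \<beta>" "(comparable_in V)\<^sup>*\<^sup>* x' y'"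
      using to_fibre \<open>x \<in> V\<close> \<open>x' \<in> V\<close> by blast
    have "(comparable_in V)\<^sup>*\<^sup>* x y'"
      using y(2) fibre[OF y(1) y'(1)] by (rule rtranclp_trans)
    then show ?thesis
      using zigzag_sym[OF y'(2)] by (rule rtranclp_trans)
  qed
  then show ?thesis
    unfolding connected_in_codim_def connectedin_upset_iff_zigzag V_def[symmetric]
    using k by blast
qed

end
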